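(* For each positive integer $n$, there is a (finite non-commutative) completely simple semigroup whose commuting graph has clique number equal to $n$.
   Context: The center of a semigroup $S$ is $Z(S)=\{x\in S: xy=yx\text{ for all }y\in S\}$. For a finite non-commutative semigroup $S$, the commuting graph $\mathcal{G}(S)$ is the simple graph with vertex set $S\setminus Z(S)$ in which two distinct vertices $x,y$ are adjacent if and only if $xy=yx$. The clique number of a graph is the size of a largest set of pairwise adjacent vertices. A semigroup without a zero is completely simple if it contains no proper ideals and it contains a minimal idempotent (minimal for the partial order on idempotents given by $e\leqslant f$ if and only if $ef=fe=e$). *)

theory Defs
  imports Main "HOL-Library.Ramsey"
begin

locale semigroup_on =
  fixes S :: "'a set" and mult :: "'a \<Rightarrow> 'a \<Rightarrow> 'a" (infixl \<open>\<cdot>\<close> 70)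
  assumes nonempty: "S \<noteq> {}"
    and closed: "\<lbrakk>x \<in> S; y \<in> S\<rbrakk> \<Longrightarrow> x \<cdot> y \<in> S"
    and assoc: "\<lbrakk>x \<in> S; y \<in> S; z \<in> S\<rbrakk> \<Longrightarrow> (x \<cdot> y) \<cdot> z = x \<cdot> (y \<cdot> z)"

definition commutative_on :: "'a set \<Rightarrow> ('a \<Rightarrow> 'a \<Rightarrow> 'a) \<Rightarrow> bool" where
  "commutative_on S mult \<longleftrightarrow> (\<forall>x\<in>S. \<forall>y\<in>S. mult x y = mult y x)"

definition sg_center :: "'a set \<Rightarrow> ('a \<Rightarrow> 'a \<Rightarrow> 'a) \<Rightarrow> 'a set" where
  "sg_center S mult = {x \<in> S. \<forall>y\<in>S. mult x y = mult y x}"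

definition sg_zero :: "'a set \<Rightarrow> ('a \<Rightarrow> 'a \<Rightarrow> 'a) \<Rightarrow> 'a \<Rightarrow> bool" where
  "sg_zero S mult z \<longleftrightarrow> z \<in> S \<and> (\<forall>x\<in>S. mult z x = z \<and> mult x z = z)"

definition sg_ideal :: "'a set \<Rightarrow> ('a \<Rightarrow> 'a \<Rightarrow> 'a) \<Rightarrow> 'a set \<Rightarrow> bool" where
  "sg_ideal S mult I \<longleftrightarrow> I \<noteq> {} \<and> I \<subseteq> S \<and> (\<forall>s\<in>S. \<forall>i\<in>I. mult s i \<in> I \<and> mult i s \<in> I)"

definition sg_idempotent :: "'a set \<Rightarrow> ('a \<Rightarrow> 'a \<Rightarrow> 'a) \<Rightarrow> 'a \<Rightarrow> bool" where
  "sg_idempotent S mult e \<longleftrightarrow> e \<in> S \<and> mult e e = e"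

definition idempotent_le :: "('a \<Rightarrow> 'a \<Rightarrow> 'a) \<Rightarrow> 'a \<Rightarrow> 'a \<Rightarrow> bool" where
  "idempotent_le mult e f \<longleftrightarrow> mult e f = e \<and> mult f e = e"

definition minimal_idempotent :: "'a set \<Rightarrow> ('a \<Rightarrow> 'a \<Rightarrow> 'a) \<Rightarrow> 'a \<Rightarrow> bool" where
  "minimal_idempotent S mult e \<longleftrightarrow> sg_idempotent S mult e \<and>
     (\<forall>f. sg_idempotent S mult f \<and> idempotent_le mult f e \<longrightarrow> f = e)"

definition completely_simple :: "'a set \<Rightarrow> ('a \<Rightarrow> 'a \<Rightarrow> 'a) \<Rightarrow> bool" where
  "completely_simple S mult \<longleftrightarrow>
     semigroup_on S mult \<and>
     (\<nexists>z. sg_zero S mult z) \<and>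
     (\<nexists>I. sg_ideal S mult I \<and> I \<noteq> S) \<and>
     (\<exists>e. minimal_idempotent S mult e)"

text \<open>
  A simple graph is a pair of a vertex set and a set of two-element sets of vertices,
  which is the edge representation expected by \<^const>\<open>clique\<close>.
\<close>

definition commuting_graph :: "'a set \<Rightarrow> ('a \<Rightarrow> 'a \<Rightarrow> 'a) \<Rightarrow> 'a set \<times> 'a set set" where
  "commuting_graph S mult =
     (let V = S - sg_center S mult
      in (V, {{x, y} | x y. x \<in> V \<and> y \<in> V \<and> x \<noteq> y \<and> mult x y = mult y x}))"

text \<open>Meaningful for graphs with finitely many vertices only, because of \<^const>\<open>Max\<close>.\<close>

definition clique_number :: "'a set \<times> 'a set set \<Rightarrow> nat" where
  "clique_number G = Max {card K | K. K \<subseteq> fst G \<and> clique K (snd G)}"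

end

theory Submission
  imports Defs
begin

text \<open>
  The direct product of the two-element left zero semigroup \<open>L = {0, 1}\<close> with the cyclic group
  \<open>\<int>/n\<close> has multiplication \<open>(i, a)(j, b) = (i, a + b)\<close>. It is completely simple: right
  multiplication reaches every element of the group, left multiplication reaches every element of
  \<open>L\<close>, so there is no proper ideal, and its idempotents \<open>(i, 0)\<close> are pairwise incomparable.
  As the group is abelian, \<open>(i, a)\<close> and \<open>(j, b)\<close> commute exactly when \<open>i = j\<close>. Hence the center
  is empty and the commuting graph consists of two disjoint complete graphs on \<open>n\<close> vertices, one
  for each element of \<open>L\<close>; its clique number is \<open>n\<close>.
\<close>

text \<open>
  The pair \<open>(i, a)\<close> is encoded as the number \<open>n * i + a\<close> below \<open>2 * n\<close>, so that
  \<open>x div n\<close> is the coordinate in the left zero semigroup and \<open>x mod n\<close> the one in the group.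
\<close>

definition left_group_mult :: "nat \<Rightarrow> nat \<Rightarrow> nat \<Rightarrow> nat" where
  "left_group_mult n x y = n * (x div n) + (x + y) mod n"

lemma left_group_mult_div: "n \<ge> 1 \<Longrightarrow> left_group_mult n x y div n = x div n"
  by (simp add: left_group_mult_def)

lemma left_group_mult_mod: "left_group_mult n x y mod n = (x + y) mod n"
  by (simp add: left_group_mult_def)

lemma div_mod_eqI: "x div n = y div n \<Longrightarrow> x mod n = y mod n \<Longrightarrow> x = (y :: nat)"
  by (metis div_mult_mod_eq)

lemma left_group_mult_closed:
  assumes "n \<ge> 1" "x < 2 * n"
  shows "left_group_mult n x y < 2 * n"
proof -
  have "left_group_mult n x y div n < 2"
    using assms by (simp add: left_group_mult_div[OF assms(1)] div_less_iff_less_mult)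
  then show ?thesis
    using assms(1) by (simp add: div_less_iff_less_mult)
qed

lemma left_group_mult_assoc:
  assumes "n \<ge> 1"
  shows "left_group_mult n (left_group_mult n x y) z = left_group_mult n x (left_group_mult n y z)"
proof (rule div_mod_eqI)
  have "(left_group_mult n x y + z) mod n = ((x + y) + z) mod n"
    using left_group_mult_mod mod_add_cong by blast
  moreover have "(x + left_group_mult n y z) mod n = (x + (y + z)) mod n"
    using left_group_mult_mod mod_add_cong by blast
  ultimately show "left_group_mult n (left_group_mult n x y) z mod n
      = left_group_mult n x (left_group_mult n y z) mod n"
    by (simp add: left_group_mult_mod add.assoc)
qed (simp add: left_group_mult_div[OF assms])

lemma left_group_mult_commute_iff:
  assumes "n \<ge> 1"
  shows "left_group_mult n x y = left_group_mult n y x \<longleftrightarrow> x div n = y div n"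
  by (metis assms add.commute left_group_mult_def left_group_mult_div)

text \<open>
  An element \<open>s\<close> lies in the ideal generated by \<open>i\<close> because it equals \<open>s i t\<close>, where the group
  coordinate of \<open>t\<close> is inverse to that of \<open>i\<close>.
\<close>

lemma left_group_simple:
  assumes n: "n \<ge> 1" and I: "sg_ideal {..<2 * n} (left_group_mult n) I"
  shows "I = {..<2 * n}"
proof
  show "I \<subseteq> {..<2 * n}"
    using I by (simp add: sg_ideal_def)
  show "{..<2 * n} \<subseteq> I"
  proof
    fix s assume s: "s \<in> {..<2 * n}"
    obtain i where i: "i \<in> I"
      using I by (auto simp: sg_ideal_def)
    define t where "t = n - i mod n"
    have "t \<in> {..<2 * n}"
      using n by (simp add: t_def)
    then have "left_group_mult n (left_group_mult n s i) t \<in> I"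
      using I s i by (simp add: sg_ideal_def)
    moreover have "left_group_mult n (left_group_mult n s i) t = s"
    proof (rule div_mod_eqI)
      have "i mod n + t = n"
        using n by (simp add: t_def)
      moreover have "(left_group_mult n s i + t) mod n = (s + i + t) mod n"
        using left_group_mult_mod mod_add_cong by blast
      moreover have "(s + i + t) mod n = (s + (i mod n + t)) mod n"
        by (metis add.assoc mod_add_left_eq mod_add_right_eq)
      ultimately show "left_group_mult n (left_group_mult n s i) t mod n = s mod n"
        by (simp add: left_group_mult_mod)
    qed (simp add: left_group_mult_div[OF n])
    ultimately show "s \<in> I"
      by simp
  qed
qed

lemma left_group_completely_simple:
  assumes n: "n \<ge> 1"
  shows "completely_simple {..<2 * n} (left_group_mult n)"
  unfolding completely_simple_def
proof (intro conjI)
  show "semigroup_on {..<2 * n} (left_group_mult n)"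
    using n by unfold_locales
      (auto simp: left_group_mult_closed[OF n] left_group_mult_assoc[OF n] lessThan_empty_iff)
  \<comment> \<open>A zero would commute both with \<open>0\<close> and with \<open>n\<close>, whose left zero coordinates differ.\<close>
  show "\<nexists>z. sg_zero {..<2 * n} (left_group_mult n) z"
  proof
    assume "\<exists>z. sg_zero {..<2 * n} (left_group_mult n) z"
    then obtain z where z: "\<And>x. x < 2 * n \<Longrightarrow> left_group_mult n x z = left_group_mult n z x"
      unfolding sg_zero_def by (metis lessThan_iff)
    have "0 div n = z div n" "n div n = z div n"
      using z[of 0] z[of n] n by (simp_all only: left_group_mult_commute_iff[OF n])
    then show False
      using n by simp
  qed
  show "\<nexists>I. sg_ideal {..<2 * n} (left_group_mult n) I \<and> I \<noteq> {..<2 * n}"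
    using left_group_simple[OF n] by blast
  have "f = 0" if ff: "left_group_mult n f f = f" and le: "left_group_mult n 0 f = f" for f
  proof (rule div_mod_eqI[where n = n])
    show "f div n = 0 div n"
      using left_group_mult_div[OF n, of 0 f] le by simp
    have "(f + f) mod n = f mod n"
      using left_group_mult_mod[of n f f] ff by simp
    then have "n dvd (f + f) - f"
      by (metis le_add1 mod_eq_dvd_iff_nat)
    then show "f mod n = 0 mod n"
      by simp
  qed
  then have "minimal_idempotent {..<2 * n} (left_group_mult n) 0"
    using n by (auto simp: minimal_idempotent_def sg_idempotent_def idempotent_le_def
        left_group_mult_def[of n 0 0])
  then show "\<exists>e. minimal_idempotent {..<2 * n} (left_group_mult n) e" ..
qed

lemma left_group_center:
  assumes n: "n \<ge> 1"
  shows "sg_center {..<2 * n} (left_group_mult n) = {}"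
proof -
  have False if "\<forall>y<2 * n. x div n = y div n" for x
    using that[rule_format, of 0] that[rule_format, of n] n by simp
  then show ?thesis
    by (auto simp: sg_center_def left_group_mult_commute_iff[OF n])
qed

lemma left_group_clique_iff:
  assumes n: "n \<ge> 1" and K: "K \<subseteq> {..<2 * n}"
  shows "clique K (snd (commuting_graph {..<2 * n} (left_group_mult n)))
    \<longleftrightarrow> (\<forall>x\<in>K. \<forall>y\<in>K. x div n = y div n)"
proof -
  have "{x, y} \<in> snd (commuting_graph {..<2 * n} (left_group_mult n)) \<longleftrightarrow> x div n = y div n"
    if "x \<in> K" "y \<in> K" "x \<noteq> y" for x y
    using that K
    by (auto simp: commuting_graph_def left_group_center[OF n] left_group_mult_commute_iff[OF n]
        doubleton_eq_iff)
  then show ?thesis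
    unfolding clique_def by metis
qed

lemma left_group_clique_number:
  assumes n: "n \<ge> 1"
  shows "clique_number (commuting_graph {..<2 * n} (left_group_mult n)) = n"
proof -
  let ?G = "commuting_graph {..<2 * n} (left_group_mult n)"
  have V: "fst ?G = {..<2 * n}"
    by (simp add: commuting_graph_def left_group_center[OF n])
  have bound: "card K \<le> n" if K: "K \<subseteq> {..<2 * n}" and cl: "clique K (snd ?G)" for K
  proof -
    have "inj_on (\<lambda>x. x mod n) K"
      using cl by (auto simp: left_group_clique_iff[OF n K] intro!: inj_onI intro: div_mod_eqI)
    moreover have "(\<lambda>x. x mod n) ` K \<subseteq> {..<n}"
      using n by auto
    ultimately show ?thesis
      using card_inj_on_le[of _ K "{..<n}"] by simp
  qed
  have attained: "{..<n} \<subseteq> {..<2 * n} \<and> clique {..<n} (snd ?G)"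
    by (auto simp: left_group_clique_iff[OF n])
  show ?thesis
    unfolding clique_number_def V
  proof (rule Max_eqI)
    have "{card K |K. K \<subseteq> {..<2 * n} \<and> clique K (snd ?G)} \<subseteq> {..n}"
      using bound by auto
    then show "finite {card K |K. K \<subseteq> {..<2 * n} \<and> clique K (snd ?G)}"
      using finite_subset by blast
    show "n \<in> {card K |K. K \<subseteq> {..<2 * n} \<and> clique K (snd ?G)}"
      using attained by (metis (mono_tags, lifting) card_lessThan mem_Collect_eq)
  qed (use bound in auto)
qed

theorem corollary4p1:
  fixes n :: nat
  assumes "n \<ge> 1"
  shows "\<exists>(S :: nat set) (mult :: nat \<Rightarrow> nat \<Rightarrow> nat).
           finite S \<and> \<not> commutative_on S mult \<and> completely_simple S mult \<and>
           clique_number (commuting_graph S mult) = n"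
proof (intro exI conjI)
  show "\<not> commutative_on {..<2 * n} (left_group_mult n)"
    using left_group_center[OF assms] assms
    by (auto simp: commutative_on_def sg_center_def intro!: exI[of _ 0])
qed (use assms left_group_completely_simple left_group_clique_number in auto)

end
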